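(* Let $\beta>0$, let $c:G\to\mathbb{R}$ be a continuous cocycle, and let $L_{-\beta c}$ be the Haar-Ruelle operator $$L_{-\beta c}(f)(x)=\frac1d\sum_{j=1}^{d}\ \sum_{s\in[j*x]} f(s)\,e^{-\beta c(j*x,\,s)},\qquad x\in X.$$ Let $M$ be a finite Borel measure on $X$ such that $L_{-\beta c}^{*}M=\lambda M$ for some $\lambda>0$. Then $M$ is $(c,\beta)$-quasi-invariant, that is, $$\int_X\sum_{s\in[x]} h(s,x)\,dM(x)=\int_X\sum_{s\in[x]} h(x,s)\,e^{-\beta c(x,s)}\,dM(x)$$ for every integrable function $h:G\to\mathbb{R}$.
   Context: Let $d\ge 1$ be an integer and $X=\{1,\dots,d\}^{\mathbb{N}}$, a compact metric space with the usual metric $d_X(x,z)=2^{-\min\{n\ge1:\ x_n\ne z_n\}}$ ($d_X(x,x)=0$). For $j\in\{1,\dots,d\}$ and $x=(x_1,x_2,\dots)\in X$ write $j*x=(j,x_1,x_2,\dots)$. Let $\sim$ be an equivalence relation on $X$ with finite classes $[x]=\{s\in X: s\sim x\}$, such that $x\mapsto[x]$ is hemicontinuous as a multivalued map. Let $G=\{(x,y)\in X^2: x\sim y\}$ with the topology induced from $X^2$. For each $x$, $\nu^x$ denotes the counting measure on $[x]$. The relation $\sim$ (the groupoid $G$) is assumed continuous with respect to the symbolic structure: the elements of each class $[y]$ are listed (each exactly once) as an ordered tuple $(\psi_1(y),\dots,\psi_k(y))$, $k=\sharp[y]$, where this ordered list depends only on the class $[y]$, and for every $\varepsilon>0$ there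 is $\delta>0$ such that, whenever $d_X(x,z)<\delta$ and $1\le j\le d$, one has $\sharp[j*x]=\sharp[j*z]=:k$ and $\max_{1\le i\le k} d_X(\psi_i(j*x),\psi_i(j*z))<\varepsilon$. A cocycle is a function $c:G\to\mathbb{R}$ with $c(x,z)=c(x,y)+c(y,z)$ for all $x\sim y\sim z$. The dual $L^*$ of an operator $L$ on $C^0(X)$ acts on finite Borel measures by $\int f\,d(L^*M)=\int L(f)\,dM$ for $f\in C^0(X)$. In the quasi-invariance condition, "integrable $h$" means a Borel function $h$ for which both double integrals converge absolutely. *)

theory Defs
  imports "HOL-Analysis.Analysis"
begin

text \<open>
  Sequences are indexed from 0 here: the coordinate written \<open>x\<^sub>n\<close> with \<open>n \<ge> 1\<close> in the mathematics
  is \<open>x (n - 1)\<close>.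
\<close>

type_synonym point = "nat \<Rightarrow> nat"

definition seqs :: "nat \<Rightarrow> point set" where
  "seqs d = {x. \<forall>n. x n \<in> {1..d}}"

text \<open>
  The index shift turns \<open>min {n \<ge> 1. x\<^sub>n \<noteq> z\<^sub>n}\<close> into \<open>Suc (LEAST n. x n \<noteq> z n)\<close>.
\<close>

definition seq_dist :: "point \<Rightarrow> point \<Rightarrow> real" where
  "seq_dist x z = (if x = z then 0 else (1/2) ^ Suc (LEAST n. x n \<noteq> z n))"

definition cons_seq :: "nat \<Rightarrow> point \<Rightarrow> point"  (infixr "\<star>" 65) where
  "j \<star> x = case_nat j x"

text \<open>
  All topological notions on \<open>seqs d\<close> and its square (open sets, continuity, Borel sets) are taken
  from the topology that the type \<open>nat \<Rightarrow> nat\<close> has in the library, the product of discrete topologies.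
  The next lemmas verify that on \<open>seqs d\<close> this is the topology of the metric \<open>seq_dist\<close>.
\<close>

lemma seq_dist_less_iff: "seq_dist x z < (1/2) ^ n \<longleftrightarrow> (\<forall>i<n. x i = z i)"
proof (cases "x = z")
  case False
  then have "\<exists>i. x i \<noteq> z i" by auto
  define m where "m = (LEAST i. x i \<noteq> z i)"
  have m: "x m \<noteq> z m"
    unfolding m_def using \<open>\<exists>i. x i \<noteq> z i\<close> by (rule LeastI_ex)
  have below: "x i = z i" if "i < m" for i
    using not_less_Least[of i "\<lambda>i. x i \<noteq> z i"] that by (auto simp: m_def)
  have "seq_dist x z < (1/2) ^ n \<longleftrightarrow> (1/2::real) ^ Suc m < (1/2) ^ n"
    using False by (simp add: seq_dist_def m_def)
  also have "\<dots> \<longleftrightarrow> n < Suc m"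
    by (rule power_strict_decreasing_iff) auto
  also have "\<dots> \<longleftrightarrow> (\<forall>i<n. x i = z i)"
    using m below by (metis less_Suc_eq_le not_less_eq_eq order.strict_trans2 not_le)
  finally show ?thesis .
qed (simp add: seq_dist_def)

lemma Metric_space_seqs: "Metric_space (seqs d) seq_dist"
proof
  show "0 \<le> seq_dist x y" for x y by (simp add: seq_dist_def)
  show "seq_dist x y = seq_dist y x" for x y
    by (simp add: seq_dist_def eq_commute[of "x _"] eq_commute[of x])
  show "seq_dist x y = 0 \<longleftrightarrow> x = y" for x y by (simp add: seq_dist_def)
  show "seq_dist x z \<le> seq_dist x y + seq_dist y z" for x y z
  proof (rule ccontr)
    assume "\<not> ?thesis"
    then have lt: "seq_dist x y + seq_dist y z < seq_dist x z" by simp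
    have nonneg: "0 \<le> seq_dist x y" "0 \<le> seq_dist y z" by (simp_all add: seq_dist_def)
    with lt have "x \<noteq> z" by (auto simp: seq_dist_def split: if_splits)
    then obtain k where k: "seq_dist x z = (1/2) ^ k" unfolding seq_dist_def by metis
    have "seq_dist x y < (1/2) ^ k" "seq_dist y z < (1/2) ^ k"
      using lt nonneg k by linarith+
    then have "seq_dist x z < (1/2) ^ k" unfolding seq_dist_less_iff by simp
    with k show False by simp
  qed
qed

lemma open_seq_contains_cylinder:
  fixes U :: "point set"
  assumes "open U" "x \<in> U"
  shows "\<exists>n. {z. \<forall>i<n. x i = z i} \<subseteq> U"
proof -
  have "openin (product_topology (\<lambda>i. euclidean) UNIV) U"
    using assms(1) by (simp add: open_fun_def)
  from product_topology_open_contains_basis[OF this assms(2)]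
  obtain A where A: "x \<in> Pi\<^sub>E UNIV A" "finite {i. A i \<noteq> (UNIV :: nat set)}" "Pi\<^sub>E UNIV A \<subseteq> U"
    by auto
  then obtain n where n: "\<And>i. A i \<noteq> UNIV \<Longrightarrow> i < n"
    by (auto simp: finite_nat_set_iff_bounded)
  have "{z. \<forall>i<n. x i = z i} \<subseteq> Pi\<^sub>E UNIV A"
  proof
    fix z assume z: "z \<in> {z. \<forall>i<n. x i = z i}"
    have "z i \<in> A i" for i
    proof (cases "A i = UNIV")
      case False
      then have "z i = x i" using n z by force
      then show ?thesis using A(1) by (auto simp: PiE_iff)
    qed auto
    then show "z \<in> Pi\<^sub>E UNIV A" by auto
  qed
  with A(3) show ?thesis by blast
qed

lemma open_cylinder: "open {z :: point. \<forall>i<n. x i = z i}"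
proof -
  have "open {f :: point. \<forall>i\<in>{..<n}. f i \<in> {x i}}"
    by (rule product_topology_basis') (auto simp: open_discrete)
  also have "{f :: point. \<forall>i\<in>{..<n}. f i \<in> {x i}} = {z. \<forall>i<n. x i = z i}" by auto
  finally show ?thesis .
qed

lemma mtopology_seqs: "Metric_space.mtopology (seqs d) seq_dist = top_of_set (seqs d)"
proof -
  interpret Metric_space "seqs d" seq_dist by (rule Metric_space_seqs)
  have ball: "mball x ((1/2) ^ n) = {z. \<forall>i<n. x i = z i} \<inter> seqs d" if "x \<in> seqs d" for x n
    using that by (auto simp: mball_def seq_dist_less_iff)
  show ?thesis
  proof (rule topology_eq[THEN iffD2], intro allI iffI)
    fix U assume U: "openin mtopology U"
    then have sub: "U \<subseteq> seqs d" by (simp add: openin_mtopology)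
    have "\<exists>T. openin (top_of_set (seqs d)) T \<and> x \<in> T \<and> T \<subseteq> U" if x: "x \<in> U" for x
    proof -
      obtain r where r: "r > 0" "mball x r \<subseteq> U" using U x by (auto simp: openin_mtopology)
      obtain n where n: "(1/2::real) ^ n < r" using real_arch_pow_inv[OF r(1), of "1/2"] by auto
      have "mball x ((1/2) ^ n) \<subseteq> mball x r" using n by (intro mball_subset_concentric) simp
      with r(2) have "seqs d \<inter> {z. \<forall>i<n. x i = z i} \<subseteq> U" using ball[of x n] sub x by blast
      moreover have "openin (top_of_set (seqs d)) (seqs d \<inter> {z. \<forall>i<n. x i = z i})"
        by (intro openin_open_Int open_cylinder)
      ultimately show ?thesis using x sub by blast
    qed
    then show "openin (top_of_set (seqs d)) U" by (subst openin_subopen) blast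
  next
    fix U assume "openin (top_of_set (seqs d)) U"
    then obtain V where V: "open V" "U = seqs d \<inter> V" by (auto simp: openin_open)
    have "\<exists>r>0. mball x r \<subseteq> U" if x: "x \<in> U" for x
    proof -
      obtain n where "{z. \<forall>i<n. x i = z i} \<subseteq> V"
        using open_seq_contains_cylinder[of V x] V x by auto
      then have "mball x ((1/2) ^ n) \<subseteq> U" using ball[of x n] V x by blast
      then show ?thesis by (intro exI[of _ "(1/2) ^ n"]) simp
    qed
    then show "openin mtopology U" using V by (auto simp: openin_mtopology)
  qed
qed

text \<open>
  The equivalence relation is the groupoid \<open>G\<close> itself, viewed as a set of pairs; the class of \<open>x\<close>
  is \<open>G `` {x}\<close>.
\<close>

definition hemicontinuous_classes :: "nat \<Rightarrow> (point \<times> point) set \<Rightarrow> bool" where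
  "hemicontinuous_classes d G \<longleftrightarrow>
     (\<forall>U. openin (top_of_set (seqs d)) U \<longrightarrow>
        openin (top_of_set (seqs d)) {x \<in> seqs d. G `` {x} \<subseteq> U} \<and>
        openin (top_of_set (seqs d)) {x \<in> seqs d. G `` {x} \<inter> U \<noteq> {}})"

text \<open>
  \<open>\<psi> i y\<close> is the \<open>i\<close>-th entry of the list of the class of \<open>y\<close>; its values for \<open>i\<close> outside
  \<open>{1..card (G `` {y})}\<close> are irrelevant.
\<close>

definition continuous_groupoid :: "nat \<Rightarrow> (point \<times> point) set \<Rightarrow> bool" where
  "continuous_groupoid d G \<longleftrightarrow>
     (\<exists>\<psi> :: nat \<Rightarrow> point \<Rightarrow> point.
        (\<forall>y\<in>seqs d. bij_betw (\<lambda>i. \<psi> i y) {1..card (G `` {y})} (G `` {y})) \<and>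
        (\<forall>(y, z)\<in>G. \<forall>i\<in>{1..card (G `` {y})}. \<psi> i y = \<psi> i z) \<and>
        (\<forall>\<epsilon>>0. \<exists>\<delta>>0. \<forall>x\<in>seqs d. \<forall>z\<in>seqs d. \<forall>j\<in>{1..d}. seq_dist x z < \<delta> \<longrightarrow>
           card (G `` {j \<star> x}) = card (G `` {j \<star> z}) \<and>
           (MAX i\<in>{1..card (G `` {j \<star> x})}. seq_dist (\<psi> i (j \<star> x)) (\<psi> i (j \<star> z))) < \<epsilon>))"

definition cocycle :: "(point \<times> point) set \<Rightarrow> (point \<times> point \<Rightarrow> real) \<Rightarrow> bool" where
  "cocycle G c \<longleftrightarrow>
     (\<forall>x y z. (x, y) \<in> G \<longrightarrow> (y, z) \<in> G \<longrightarrow> c (x, z) = c (x, y) + c (y, z))"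

text \<open>The Haar-Ruelle operator \<open>L\<^bsub>-\<beta>c\<^esub>\<close>, given by \<open>\<beta>\<close> and \<open>c\<close>.\<close>

definition haar_ruelle ::
    "nat \<Rightarrow> (point \<times> point) set \<Rightarrow> real \<Rightarrow> (point \<times> point \<Rightarrow> real) \<Rightarrow> (point \<Rightarrow> real) \<Rightarrow> point \<Rightarrow> real" where
  "haar_ruelle d G \<beta> c f x =
     1 / real d * (\<Sum>j=1..d. \<Sum>s\<in>G `` {j \<star> x}. f s * exp (- \<beta> * c (j \<star> x, s)))"

definition finite_borel_measure :: "nat \<Rightarrow> point measure \<Rightarrow> bool" where
  "finite_borel_measure d M \<longleftrightarrow>
     finite_measure M \<and> sets M = sets (restrict_space borel (seqs d))"

text \<open>
  \<open>is_dual_image d L M N\<close> says \<open>L\<^sup>* M = N\<close>. The dual is a relation because the measure \<open>L\<^sup>* M\<close> is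
  given only through its integrals against continuous functions.
\<close>

definition is_dual_image ::
    "nat \<Rightarrow> ((point \<Rightarrow> real) \<Rightarrow> point \<Rightarrow> real) \<Rightarrow> point measure \<Rightarrow> point measure \<Rightarrow> bool" where
  "is_dual_image d L M N \<longleftrightarrow>
     finite_borel_measure d N \<and>
     (\<forall>f. continuous_on (seqs d) f \<longrightarrow> integral\<^sup>L N f = integral\<^sup>L M (L f))"

definition quasi_invariant ::
    "(point \<times> point) set \<Rightarrow> (point \<times> point \<Rightarrow> real) \<Rightarrow> real \<Rightarrow> point measure \<Rightarrow> bool" where
  "quasi_invariant G c \<beta> M \<longleftrightarrow>
     (\<forall>h :: point \<times> point \<Rightarrow> real.
        h \<in> borel_measurable (restrict_space borel G) \<longrightarrow>
        integrable M (\<lambda>x. \<Sum>s\<in>G `` {x}. \<bar>h (s, x)\<bar>) \<longrightarrow>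
        integrable M (\<lambda>x. \<Sum>s\<in>G `` {x}. \<bar>h (x, s)\<bar> * exp (- \<beta> * c (x, s))) \<longrightarrow>
        (\<integral>x. (\<Sum>s\<in>G `` {x}. h (s, x)) \<partial>M) =
        (\<integral>x. (\<Sum>s\<in>G `` {x}. h (x, s) * exp (- \<beta> * c (x, s))) \<partial>M))"

end

theory Submission
  imports Defs
begin

text \<open>
  Put \<open>u(x) = \<Sum>\<^bsub>s \<sim> x\<^esub> h(s, x)\<close> and \<open>v(x) = \<Sum>\<^bsub>s \<sim> x\<^esub> h(x, s) e\<^bsup>-\<beta>c(x, s)\<^esup>\<close>. By the cocycle identity the
  Haar-Ruelle operator \<open>L\<close> maps \<open>u\<close> and \<open>v\<close> to the same function, so integrating \<open>L u = L v\<close> against the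
  eigenmeasure \<open>M\<close> gives \<open>\<lambda> \<integral>u dM = \<lambda> \<integral>v dM\<close>. The eigenvalue equation is known for continuous
  functions only. It extends to Borel functions because indicators of clopen sets are continuous and
  the clopen sets are an intersection-stable generator of the Borel sets of the sequence space;
  continuity of the selections \<open>\<psi>\<^sub>i\<close> makes class sums measurable.
\<close>

section \<open>Continuity of the class listing and measurability of class sums\<close>

lemma open_in_seqsI:
  assumes "A \<subseteq> seqs d"
    and "\<And>x. x \<in> A \<Longrightarrow> \<exists>n. \<forall>z\<in>seqs d. (\<forall>i<n. x i = z i) \<longrightarrow> z \<in> A"
  shows "openin (top_of_set (seqs d)) A"
proof (subst openin_subopen, intro ballI)
  fix x assume x: "x \<in> A"
  obtain n where n: "\<forall>z\<in>seqs d. (\<forall>i<n. x i = z i) \<longrightarrow> z \<in> A" using assms(2)[OF x] by auto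
  have "openin (top_of_set (seqs d)) (seqs d \<inter> {z. \<forall>i<n. x i = z i})"
    by (intro openin_open_Int open_cylinder)
  then show "\<exists>T. openin (top_of_set (seqs d)) T \<and> x \<in> T \<and> T \<subseteq> A"
    using n x assms(1) by blast
qed

text \<open>The assumed continuity concerns points of the form \<open>j \<star> x\<close> and
  distances. Every sequence has this form, with \<open>j\<close> its first symbol, and distances
  below a power of 1/2 amount to agreement of initial coordinates. Both radii thus become numbers of
  coordinates, and the uniform condition applies to all pairs of nearby points.\<close>

lemma continuous_groupoidE:
  assumes "continuous_groupoid d G" "equiv (seqs d) G" "\<And>x. x \<in> seqs d \<Longrightarrow> finite (G `` {x})"
  obtains \<psi> :: "nat \<Rightarrow> point \<Rightarrow> point" where
    "\<And>y. y \<in> seqs d \<Longrightarrow> bij_betw (\<lambda>i. \<psi> i y) {1..card (G `` {y})} (G `` {y})"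
    "\<And>m. \<exists>N. \<forall>y\<in>seqs d. \<forall>z\<in>seqs d. (\<forall>i<N. y i = z i) \<longrightarrow> card (G `` {y}) = card (G `` {z}) \<and>
       (\<forall>i\<in>{1..card (G `` {y})}. \<forall>k<m. \<psi> i y k = \<psi> i z k)"
proof -
  obtain \<psi> :: "nat \<Rightarrow> point \<Rightarrow> point" where
    bij: "\<forall>y\<in>seqs d. bij_betw (\<lambda>i. \<psi> i y) {1..card (G `` {y})} (G `` {y})" and
    cont: "\<forall>\<epsilon>>0. \<exists>\<delta>>0. \<forall>x\<in>seqs d. \<forall>z\<in>seqs d. \<forall>j\<in>{1..d}. seq_dist x z < \<delta> \<longrightarrow>
           card (G `` {j \<star> x}) = card (G `` {j \<star> z}) \<and>
           (MAX i\<in>{1..card (G `` {j \<star> x})}. seq_dist (\<psi> i (j \<star> x)) (\<psi> i (j \<star> z))) < \<epsilon>"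
    using assms(1) unfolding continuous_groupoid_def by blast
  show thesis
  proof (rule that[of \<psi>])
    show "bij_betw (\<lambda>i. \<psi> i y) {1..card (G `` {y})} (G `` {y})" if "y \<in> seqs d" for y
      using bij that by blast
    fix m :: nat
    have "(0::real) < (1/2) ^ m" by simp
    then obtain \<delta> where \<delta>: "\<delta> > 0" "\<forall>x\<in>seqs d. \<forall>z\<in>seqs d. \<forall>j\<in>{1..d}. seq_dist x z < \<delta> \<longrightarrow>
           card (G `` {j \<star> x}) = card (G `` {j \<star> z}) \<and>
           (MAX i\<in>{1..card (G `` {j \<star> x})}. seq_dist (\<psi> i (j \<star> x)) (\<psi> i (j \<star> z))) < (1/2) ^ m"
      using cont by blast
    obtain N where N: "(1/2::real) ^ N < \<delta>" using real_arch_pow_inv[OF \<delta>(1), of "1/2"] by auto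
    have "card (G `` {y}) = card (G `` {z}) \<and>
       (\<forall>i\<in>{1..card (G `` {y})}. \<forall>k<m. \<psi> i y k = \<psi> i z k)"
      \<comment> \<open>Of the \<open>Suc N\<close> common coordinates, one supplies the common
        first symbol \<open>y 0 = z 0\<close>, and the other \<open>N\<close> make the shifted
        sequences \<open>y'\<close> and \<open>z'\<close> closer than \<delta>.\<close>
      if y: "y \<in> seqs d" and z: "z \<in> seqs d" and agree: "\<forall>i<Suc N. y i = z i" for y z
    proof -
      define y' z' where "y' = (\<lambda>n. y (Suc n))" and "z' = (\<lambda>n. z (Suc n))"
      have eq: "y 0 \<star> y' = y" "y 0 \<star> z' = z"
        using agree by (auto simp: cons_seq_def y'_def z'_def fun_eq_iff split: nat.split)
      have mem: "y' \<in> seqs d" "z' \<in> seqs d" "y 0 \<in> {1..d}"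
        using y z by (auto simp: seqs_def y'_def z'_def)
      have "seq_dist y' z' < (1/2) ^ N" 
        using agree by (auto simp: seq_dist_less_iff y'_def z'_def)
      then have "seq_dist y' z' < \<delta>" using N by linarith
      then have *: "card (G `` {y}) = card (G `` {z})"
        "(MAX i\<in>{1..card (G `` {y})}. seq_dist (\<psi> i y) (\<psi> i z)) < (1/2) ^ m"
        using \<delta>(2)[rule_format, OF mem] unfolding eq by auto
      have "\<psi> i y k = \<psi> i z k" if "i \<in> {1..card (G `` {y})}" "k < m" for i k
      proof -
        have "seq_dist (\<psi> i y) (\<psi> i z) \<le> (MAX i\<in>{1..card (G `` {y})}. seq_dist (\<psi> i y) (\<psi> i z))"
          using that by (intro Max_ge) auto
        with *(2) have "seq_dist (\<psi> i y) (\<psi> i z) < (1/2) ^ m" by linarith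
        then show ?thesis using that(2) by (simp add: seq_dist_less_iff)
      qed
      with *(1) show ?thesis by blast
    qed
    then show "\<exists>N. \<forall>y\<in>seqs d. \<forall>z\<in>seqs d. (\<forall>i<N. y i = z i) \<longrightarrow> card (G `` {y}) = card (G `` {z}) \<and>
       (\<forall>i\<in>{1..card (G `` {y})}. \<forall>k<m. \<psi> i y k = \<psi> i z k)" by blast
  qed
qed

text \<open>The sets \<open>E n\<close> of points with exactly \<open>n\<close> equivalent points
  are open, and countably many of them cover the space. On \<open>E n\<close> the class sum is a sum
  over \<open>i = 1..n\<close> of F composed with the continuous map sending \<open>x\<close> to
  \<open>(x, \<psi> i x)\<close>. The value type is left general to serve both real and
  \<open>ennreal\<close> integrands.\<close>

lemma measurable_class_sum:
  fixes F :: "point \<times> point \<Rightarrow> 'b::{second_countable_topology, topological_comm_monoid_add}"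
  assumes G: "continuous_groupoid d G" "equiv (seqs d) G" "\<And>x. x \<in> seqs d \<Longrightarrow> finite (G `` {x})"
    and F: "F \<in> borel_measurable (restrict_space borel G)"
  shows "(\<lambda>x. \<Sum>s\<in>G `` {x}. F (x, s)) \<in> borel_measurable (restrict_space borel (seqs d))"
proof -
  obtain \<psi> :: "nat \<Rightarrow> point \<Rightarrow> point" where
    bij: "\<And>y. y \<in> seqs d \<Longrightarrow> bij_betw (\<lambda>i. \<psi> i y) {1..card (G `` {y})} (G `` {y})" and
    cont: "\<And>m. \<exists>N. \<forall>y\<in>seqs d. \<forall>z\<in>seqs d. (\<forall>i<N. y i = z i) \<longrightarrow> card (G `` {y}) = card (G `` {z}) \<and>
       (\<forall>i\<in>{1..card (G `` {y})}. \<forall>k<m. \<psi> i y k = \<psi> i z k)"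
    using continuous_groupoidE[OF G] by blast
  define E where "E n = {y \<in> seqs d. card (G `` {y}) = n}" for n
  have E_sub: "E n \<subseteq> seqs d" for n by (auto simp: E_def)
  have E_open: "openin (top_of_set (seqs d)) (E n)" for n
  proof (rule open_in_seqsI[OF E_sub])
    fix x assume "x \<in> E n"
    \<comment> \<open>For \<open>m = 0\<close> the condition on coordinates is empty, so only local
      constancy of the class size remains.\<close>
    with cont[of 0] show "\<exists>N. \<forall>z\<in>seqs d. (\<forall>i<N. x i = z i) \<longrightarrow> z \<in> E n"
      unfolding E_def by (metis (mono_tags, lifting) mem_Collect_eq)
  qed
  have \<psi>_cont: "continuous_on (E n) (\<psi> i)" if i: "i \<in> {1..n}" for n i
    unfolding continuous_on_topological
  proof (intro ballI allI impI)
    fix x B assume x: "x \<in> E n" and B: "open B" "\<psi> i x \<in> B"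
    obtain m where m: "{z. \<forall>k<m. \<psi> i x k = z k} \<subseteq> B" using open_seq_contains_cylinder[OF B] by auto
    obtain N where N: "\<forall>y\<in>seqs d. \<forall>z\<in>seqs d. (\<forall>i<N. y i = z i) \<longrightarrow> card (G `` {y}) = card (G `` {z}) \<and>
       (\<forall>i\<in>{1..card (G `` {y})}. \<forall>k<m. \<psi> i y k = \<psi> i z k)" using cont[of m] by auto
    have "\<psi> i y \<in> B" if "y \<in> E n" "\<forall>k<N. x k = y k" for y
      using N[rule_format, of x y] that x i m by (auto simp: E_def)
    then show "\<exists>A. open A \<and> x \<in> A \<and> (\<forall>y\<in>E n. y \<in> A \<longrightarrow> \<psi> i y \<in> B)"
      using open_cylinder[of N x] by (intro exI[of _ "{z. \<forall>k<N. x k = z k}"]) auto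
  qed
  show ?thesis
  proof (rule measurable_piecewise_restrict[of "range E"])
    fix \<Omega> assume "\<Omega> \<in> range E"
    then obtain n where n: "\<Omega> = E n" by auto
    obtain T where T: "open T" "E n = seqs d \<inter> T" using E_open[of n] by (auto simp: openin_open)
    have "\<Omega> \<inter> space (restrict_space borel (seqs d)) = seqs d \<inter> T"
      unfolding n T(2) space_restrict_space by auto
    then show "\<Omega> \<inter> space (restrict_space borel (seqs d)) \<in> sets (restrict_space borel (seqs d))"
      unfolding sets_restrict_space using borel_open[OF T(1)] by simp
    \<comment> \<open>Since \<open>E n\<close> lies in \<open>seqs d\<close>, restricting the Borel
      sets in two stages gives the same sigma-algebra as restricting once to
      \<open>E n\<close>.\<close>
    have "E n \<inter> (seqs d \<inter> S) = E n \<inter> S" for S using E_sub[of n] by blast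
    then have sets_eq: "sets (restrict_space (restrict_space borel (seqs d)) (E n)) = sets (restrict_space borel (E n))"
      by (simp add: sets_restrict_space image_image)
    have "(\<lambda>x. \<Sum>i=1..n. F (x, \<psi> i x)) \<in> borel_measurable (restrict_space borel (E n))"
    proof (rule borel_measurable_sum)
      fix i assume i: "i \<in> {1..n}"
      have "(\<lambda>x. (x, \<psi> i x)) \<in> restrict_space borel (E n) \<rightarrow>\<^sub>M restrict_space borel G"
      proof (rule measurable_restrict_space2)
        show "(\<lambda>x. (x, \<psi> i x)) \<in> borel_measurable (restrict_space borel (E n))"
          by (intro borel_measurable_continuous_on_restrict continuous_on_Pair continuous_on_id \<psi>_cont[OF i])
        show "(\<lambda>x. (x, \<psi> i x)) \<in> space (restrict_space borel (E n)) \<rightarrow> G"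
        proof
          fix x assume "x \<in> space (restrict_space borel (E n))"
          then have x: "x \<in> seqs d" "card (G `` {x}) = n" by (auto simp: E_def space_restrict_space)
          show "(x, \<psi> i x) \<in> G" using bij_betwE[OF bij[OF x(1)]] x(2) i by auto
        qed
      qed
      from measurable_compose[OF this F]
      show "(\<lambda>x. F (x, \<psi> i x)) \<in> borel_measurable (restrict_space borel (E n))" .
    qed
    also have "?this \<longleftrightarrow> (\<lambda>x. \<Sum>s\<in>G `` {x}. F (x, s)) \<in> borel_measurable (restrict_space borel (E n))"
    proof (rule measurable_cong)
      fix x assume "x \<in> space (restrict_space borel (E n))"
      then have x: "x \<in> seqs d" "card (G `` {x}) = n" by (auto simp: E_def space_restrict_space)
      show "(\<Sum>i=1..n. F (x, \<psi> i x)) = (\<Sum>s\<in>G `` {x}. F (x, s))"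
        using sum.reindex_bij_betw[OF bij[OF x(1)], of "\<lambda>s. F (x, s)"] x(2) by simp
    qed
    finally show "(\<lambda>x. \<Sum>s\<in>G `` {x}. F (x, s)) \<in>
        borel_measurable (restrict_space (restrict_space borel (seqs d)) \<Omega>)"
      unfolding n measurable_cong_sets[OF sets_eq refl] .
  qed (auto simp: E_def space_restrict_space)
qed

section \<open>Clopen sets as a generator of the Borel sets\<close>

definition clopens :: "nat \<Rightarrow> point set set" where
  "clopens d = {A. openin (top_of_set (seqs d)) A \<and> closedin (top_of_set (seqs d)) A}"

lemma Int_stable_clopens: "Int_stable (clopens d)"
  by (auto simp: Int_stable_def clopens_def)

text \<open>The space is zero-dimensional with a countable base: every relatively open set is a
  countable union of clopen sets.\<close>

lemma sets_seqs_eq_sigma_clopens: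
  "sets (restrict_space borel (seqs d)) = sigma_sets (seqs d) (clopens d)"
proof -
  have sub: "clopens d \<subseteq> Pow (seqs d)" by (auto simp: clopens_def openin_open)
  have op: "seqs d \<inter> U \<in> sigma_sets (seqs d) (clopens d)" if U: "open U" for U
  proof -
    \<comment> \<open>\<open>A n\<close> is the union of the cylinders of length \<open>n\<close> in
      the sequence space that lie inside U. Membership depends only on the first \<open>n\<close>
      coordinates, so both \<open>A n\<close> and its complement are open.\<close>
    define A where "A n = {x \<in> seqs d. \<forall>z\<in>seqs d. (\<forall>i<n. x i = z i) \<longrightarrow> z \<in> U}" for n :: nat
    have "A n \<in> clopens d" for n
    proof -
      have "openin (top_of_set (seqs d)) (A n)" "openin (top_of_set (seqs d)) (seqs d - A n)"
        by (rule open_in_seqsI, force simp: A_def, rule exI[of _ n], force simp: A_def)+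
      then show ?thesis by (auto simp: clopens_def closedin_def A_def)
    qed
    moreover have "seqs d \<inter> U = (\<Union>n. A n)"
    proof (intro equalityI subsetI)
      fix x assume x: "x \<in> seqs d \<inter> U"
      then obtain n where "{z. \<forall>i<n. x i = z i} \<subseteq> U" using open_seq_contains_cylinder[OF U, of x] by auto
      with x show "x \<in> (\<Union>n. A n)" by (auto simp: A_def)
    qed (auto simp: A_def)
    ultimately show ?thesis by (metis sigma_sets.Basic sigma_sets.Union)
  qed
  have "sets (restrict_space borel (seqs d)) = {id -` A \<inter> seqs d | A. A \<in> sigma_sets UNIV {S. open S}}"
    by (auto simp: sets_restrict_space sets_borel image_iff)
  also have "\<dots> = sigma_sets (seqs d) {id -` A \<inter> seqs d | A. A \<in> {S. open S}}"
    by (rule sigma_sets_vimage_commute) auto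
  also have "\<dots> = sigma_sets (seqs d) ((\<inter>) (seqs d) ` {S. open S})"
    by (rule arg_cong[of _ _ "sigma_sets (seqs d)"]) auto
  also have "\<dots> = sigma_sets (seqs d) (clopens d)"
  proof (rule sigma_sets_eqI)
    fix A assume "A \<in> clopens d"
    then obtain U where "open U" "A = seqs d \<inter> U" unfolding clopens_def openin_open by blast
    then have "A \<in> (\<inter>) (seqs d) ` {S. open S}" by (simp only: image_eqI mem_Collect_eq)
    then show "A \<in> sigma_sets (seqs d) ((\<inter>) (seqs d) ` {S. open S})" by (rule sigma_sets.Basic)
  next
    fix A assume "A \<in> (\<inter>) (seqs d) ` {S. open S}"
    then obtain U where "U \<in> {S. open S}" "A = seqs d \<inter> U" by (rule imageE)
    then show "A \<in> sigma_sets (seqs d) (clopens d)" using op[of U] by (simp only: mem_Collect_eq)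
  qed
  finally show ?thesis .
qed

section \<open>The Haar-Ruelle operator on Borel functions\<close>

text \<open>Without the factor \<open>1/d\<close>, and written as an integral for a counting measure so that it commutes
  with sums and monotone limits.\<close>

definition nn_haar_ruelle ::
    "nat \<Rightarrow> (point \<times> point) set \<Rightarrow> real \<Rightarrow> (point \<times> point \<Rightarrow> real) \<Rightarrow> (point \<Rightarrow> ennreal) \<Rightarrow> point \<Rightarrow> ennreal" where
  "nn_haar_ruelle d G \<beta> c f x =
     (\<integral>\<^sup>+ p. f (snd p) * ennreal (exp (- \<beta> * c p)) \<partial>count_space (SIGMA y:(\<lambda>j. j \<star> x) ` {1..d}. G `` {y}))"

lemma cons_seq_in_seqs: "x \<in> seqs d \<Longrightarrow> j \<in> {1..d} \<Longrightarrow> j \<star> x \<in> seqs d"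
  by (auto simp: seqs_def cons_seq_def split: nat.split)

lemma inj_cons_seq: "inj (\<lambda>j. j \<star> x)"
  by (rule injI) (metis cons_seq_def old.nat.simps(4))

lemma measurable_cons_seq:
  assumes "j \<in> {1..d}"
  shows "(\<star>) j \<in> restrict_space borel (seqs d) \<rightarrow>\<^sub>M restrict_space borel (seqs d)"
proof (rule measurable_restrict_space2)
  have "continuous_on UNIV (\<lambda>x. (j \<star> x) i)" for i
    by (cases i) (auto simp: cons_seq_def intro!: continuous_intros continuous_on_product_coordinates)
  then have "continuous_on UNIV ((\<star>) j)" by (intro continuous_on_coordinatewise_then_product)
  then show "(\<star>) j \<in> borel_measurable (restrict_space borel (seqs d))"
    by (intro borel_measurable_continuous_on_restrict) (rule continuous_on_subset, auto)
qed (use cons_seq_in_seqs assms in \<open>auto simp: space_restrict_space\<close>)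

context
  fixes d :: nat and G :: "(point \<times> point) set" and c :: "point \<times> point \<Rightarrow> real" and \<beta> :: real
  assumes G: "equiv (seqs d) G" "continuous_groupoid d G" "\<And>x. x \<in> seqs d \<Longrightarrow> finite (G `` {x})"
    and c: "continuous_on G c" "cocycle G c"
begin

text \<open>The integral runs over a set of pairs, where coinciding points
  \<open>j \<star> x\<close> would be counted once. Distinct symbols give distinct points, so
  nothing is lost, and finiteness of the classes turns the integral into a finite sum.\<close>

lemma nn_haar_ruelle_eq:
  assumes "x \<in> seqs d"
  shows "nn_haar_ruelle d G \<beta> c f x =
    (\<Sum>j=1..d. \<Sum>s\<in>G `` {j \<star> x}. f s * ennreal (exp (- \<beta> * c (j \<star> x, s))))"
proof -
  have fin: "\<forall>y\<in>(\<lambda>j. j \<star> x) ` {1..d}. finite (G `` {y})"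
    using G(3) cons_seq_in_seqs[OF assms] by auto
  have "nn_haar_ruelle d G \<beta> c f x =
      (\<Sum>p\<in>(SIGMA y:(\<lambda>j. j \<star> x) ` {1..d}. G `` {y}). f (snd p) * ennreal (exp (- \<beta> * c p)))"
    unfolding nn_haar_ruelle_def using fin by (intro nn_integral_count_space_finite) auto
  also have "\<dots> = (\<Sum>y\<in>(\<lambda>j. j \<star> x) ` {1..d}. \<Sum>s\<in>G `` {y}. f s * ennreal (exp (- \<beta> * c (y, s))))"
    using fin by (subst sum.Sigma) (auto simp: case_prod_unfold)
  also have "\<dots> = (\<Sum>j=1..d. \<Sum>s\<in>G `` {j \<star> x}. f s * ennreal (exp (- \<beta> * c (j \<star> x, s))))"
    using inj_on_subset[OF inj_cons_seq[of x]] by (subst sum.reindex) auto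
  finally show ?thesis .
qed

lemma measurable_snd_groupoid:
  assumes "f \<in> borel_measurable (restrict_space borel (seqs d))"
  shows "(\<lambda>p. f (snd p)) \<in> borel_measurable (restrict_space borel G)"
proof (rule measurable_compose[OF _ assms], rule measurable_restrict_space2)
  show "snd \<in> borel_measurable (restrict_space borel G)"
    by (intro borel_measurable_continuous_on_restrict continuous_on_snd continuous_on_id)
  show "snd \<in> space (restrict_space borel G) \<rightarrow> seqs d"
    using G(1) by (auto simp: equiv_def refl_on_def space_restrict_space)
qed

lemma measurable_exp_cocycle:
  "(\<lambda>p. exp (- \<beta> * c p)) \<in> borel_measurable (restrict_space borel G)"
  by (intro borel_measurable_continuous_on_restrict continuous_intros c)

text \<open>For fixed \<open>j\<close> the inner sum is a measurable class sum evaluated at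
  \<open>j \<star> x\<close>, hence a composition with the continuous map that prepends
  \<open>j\<close>.\<close>

lemma measurable_nn_haar_ruelle:
  assumes "f \<in> borel_measurable (restrict_space borel (seqs d))"
  shows "nn_haar_ruelle d G \<beta> c f \<in> borel_measurable (restrict_space borel (seqs d))"
proof -
  have "(\<lambda>p. f (snd p) * ennreal (exp (- \<beta> * c p))) \<in> borel_measurable (restrict_space borel G)"
    using measurable_snd_groupoid[OF assms] measurable_exp_cocycle by measurable
  from measurable_class_sum[OF G(2,1,3) this]
  have *: "(\<lambda>x. \<Sum>s\<in>G `` {x}. f s * ennreal (exp (- \<beta> * c (x, s))))
      \<in> borel_measurable (restrict_space borel (seqs d))" by simp
  have "(\<lambda>x. \<Sum>j=1..d. \<Sum>s\<in>G `` {j \<star> x}. f s * ennreal (exp (- \<beta> * c (j \<star> x, s))))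
      \<in> borel_measurable (restrict_space borel (seqs d))"
    by (intro borel_measurable_sum measurable_compose[OF measurable_cons_seq *])
  also have "?this \<longleftrightarrow> ?thesis"
    by (rule measurable_cong) (auto simp: space_restrict_space nn_haar_ruelle_eq)
  finally show ?thesis .
qed

lemma nn_haar_ruelle_ennreal:
  assumes "d \<ge> 1" "x \<in> seqs d" "\<And>s. 0 \<le> f s"
  shows "nn_haar_ruelle d G \<beta> c (\<lambda>s. ennreal (f s)) x = ennreal (real d * haar_ruelle d G \<beta> c f x)"
  unfolding nn_haar_ruelle_eq[OF assms(2)] haar_ruelle_def using assms(1,3)
  by (simp add: ennreal_mult[symmetric] sum_nonneg)

lemma measurable_haar_ruelle:
  assumes "f \<in> borel_measurable (restrict_space borel (seqs d))"
  shows "haar_ruelle d G \<beta> c f \<in> borel_measurable (restrict_space borel (seqs d))"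
proof -
  have "(\<lambda>p. f (snd p) * exp (- \<beta> * c p)) \<in> borel_measurable (restrict_space borel G)"
    using measurable_snd_groupoid[OF assms] measurable_exp_cocycle by measurable
  from measurable_class_sum[OF G(2,1,3) this]
  have *: "(\<lambda>x. \<Sum>s\<in>G `` {x}. f s * exp (- \<beta> * c (x, s)))
      \<in> borel_measurable (restrict_space borel (seqs d))" by simp
  show ?thesis unfolding haar_ruelle_def
    by (intro borel_measurable_sum borel_measurable_times borel_measurable_const
        measurable_compose[OF measurable_cons_seq *])
qed

lemma haar_ruelle_nonneg: "(\<And>s. 0 \<le> f s) \<Longrightarrow> 0 \<le> haar_ruelle d G \<beta> c f x"
  unfolding haar_ruelle_def by (intro mult_nonneg_nonneg sum_nonneg) auto

lemma haar_ruelle_mono: "(\<And>s. f s \<le> g s) \<Longrightarrow> haar_ruelle d G \<beta> c f x \<le> haar_ruelle d G \<beta> c g x"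
  unfolding haar_ruelle_def by (intro mult_left_mono sum_mono mult_right_mono) auto

section \<open>Extension of the eigenvalue equation from continuous to Borel functions\<close>

context
  fixes M :: "point measure" and lam :: real
  assumes d: "d \<ge> 1" and lam: "lam > 0" and M: "finite_borel_measure d M"
    and dual: "is_dual_image d (haar_ruelle d G \<beta> c) M (scale_measure (ennreal lam) M)"
begin

lemma sets_M: "sets M = sets (restrict_space borel (seqs d))"
  using M by (simp add: finite_borel_measure_def)

lemma space_M: "space M = seqs d"
  using sets_eq_imp_space_eq[OF sets_M] by (simp add: space_restrict_space)

interpretation finite_measure M
  using M by (simp add: finite_borel_measure_def)

lemma clopens_in_sets: "A \<in> clopens d \<Longrightarrow> A \<in> sets M"
  unfolding sets_M sets_seqs_eq_sigma_clopens by auto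

text \<open>The indicator is an admissible continuous test function. Integrability of its image is
  not known at this point, so the Bochner integral on the left might still be the default value 0;
  the next lemma excludes that.\<close>

lemma integral_haar_ruelle_clopen:
  assumes "A \<in> clopens d"
  shows "integral\<^sup>L M (haar_ruelle d G \<beta> c (indicator A)) = lam * measure M A"
proof -
  have "continuous_on (seqs d) (indicator A :: point \<Rightarrow> real)"
  proof -
    have clo: "closedin (top_of_set (seqs d)) A" "closedin (top_of_set (seqs d)) (seqs d - A)" "A \<subseteq> seqs d"
      using assms by (auto simp: clopens_def closedin_def openin_open)
    \<comment> \<open>The constants 1 and 0 are glued along two disjoint relatively closed
      pieces.\<close>
    have "continuous_on (A \<union> (seqs d - A)) (\<lambda>x. if x \<in> A then 1 else (0::real))"
      using clo by (intro continuous_on_cases_local) (auto simp: Un_absorb1)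
    moreover have "A \<union> (seqs d - A) = seqs d" "(\<lambda>x. if x \<in> A then 1 else (0::real)) = indicator A"
      using clo(3) by (auto simp: indicator_def)
    ultimately show ?thesis by metis
  qed
  then have "integral\<^sup>L (scale_measure (ennreal lam) M) (indicator A) =
      integral\<^sup>L M (haar_ruelle d G \<beta> c (indicator A))"
    using dual unfolding is_dual_image_def by blast
  then show ?thesis 
    using lam clopens_in_sets[OF assms] sets.sets_into_space[of A M]
    by (simp add: measure_scale_measure Int_absorb1 Int_absorb2)
qed

text \<open>Were \<open>L 1\<close> not integrable, its integral would be \<open>0\<close> by convention, forcing \<open>M = 0\<close>.\<close>

lemma integrable_haar_ruelle_indicator:
  assumes "A \<in> sets M"
  shows "integrable M (haar_ruelle d G \<beta> c (indicator A))"
proof -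
  have meas: "haar_ruelle d G \<beta> c (indicator B) \<in> borel_measurable M" if "B \<in> sets M" for B
    using measurable_haar_ruelle[of "indicator B"] that unfolding measurable_cong_sets[OF sets_M refl]
    by (auto simp: sets_M intro!: borel_measurable_indicator)
  have X: "seqs d \<in> clopens d" by (auto simp: clopens_def)
  have 1: "integrable M (haar_ruelle d G \<beta> c (indicator (seqs d)))"
  proof (rule ccontr)
    assume "\<not> ?thesis"
    then have "lam * measure M (seqs d) = 0"
      using integral_haar_ruelle_clopen[OF X] not_integrable_integral_eq by metis
    then have "emeasure M (space M) = 0" using lam by (simp add: emeasure_eq_measure space_M)
    then have "AE x in M. haar_ruelle d G \<beta> c (indicator (seqs d)) x = 0"
      by (intro AE_I[of _ _ "space M"]) auto
    then have "integrable M (haar_ruelle d G \<beta> c (indicator (seqs d))) \<longleftrightarrow> integrable M (\<lambda>x. 0::real)"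
      using meas[OF clopens_in_sets[OF X]] by (intro integrable_cong_AE) auto
    with \<open>\<not> ?thesis\<close> show False by simp
  qed
  show ?thesis
  proof (rule Bochner_Integration.integrable_bound[OF 1 meas[OF assms]], rule AE_I2)
    fix x
    have "A \<subseteq> seqs d" using sets.sets_into_space[OF assms] space_M by simp
    then have "haar_ruelle d G \<beta> c (indicator A) x \<le> haar_ruelle d G \<beta> c (indicator (seqs d)) x"
      by (intro haar_ruelle_mono) (auto simp: indicator_def)
    then show "norm (haar_ruelle d G \<beta> c (indicator A) x) \<le> norm (haar_ruelle d G \<beta> c (indicator (seqs d)) x)"
      using haar_ruelle_nonneg[of "indicator A" x] by simp
  qed
qed

lemma measurable_nn_haar_ruelle_M [measurable]:
  "f \<in> borel_measurable M \<Longrightarrow> nn_haar_ruelle d G \<beta> c f \<in> borel_measurable M"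
  using measurable_nn_haar_ruelle by (simp add: measurable_cong_sets[OF sets_M refl])

text \<open>Dynkin's argument: the identity holds on the intersection-stable clopen sets and passes
  to complements and to countable disjoint unions. The constant is \<open>d * lam\<close> because
  \<open>nn_haar_ruelle\<close> omits the factor 1/d.\<close>

lemma nn_integral_haar_ruelle_indicator:
  assumes "A \<in> sets M"
  shows "(\<integral>\<^sup>+x. nn_haar_ruelle d G \<beta> c (indicator A) x \<partial>M) = ennreal (d * lam) * emeasure M A"
proof -
  have clopen: "(\<integral>\<^sup>+x. nn_haar_ruelle d G \<beta> c (indicator A) x \<partial>M) = ennreal (d * lam) * emeasure M A"
    if A: "A \<in> clopens d" for A
  proof -
    have "(\<integral>\<^sup>+x. nn_haar_ruelle d G \<beta> c (indicator A) x \<partial>M) =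
        (\<integral>\<^sup>+x. ennreal (real d * haar_ruelle d G \<beta> c (indicator A) x) \<partial>M)"
      using nn_haar_ruelle_ennreal[OF d, of _ "indicator A"]
      by (intro nn_integral_cong) (simp add: space_M ennreal_indicator)
    also have "\<dots> = ennreal (real d * integral\<^sup>L M (haar_ruelle d G \<beta> c (indicator A)))"
      using integrable_haar_ruelle_indicator[OF clopens_in_sets[OF A]]
      by (subst nn_integral_eq_integral) (auto intro!: mult_nonneg_nonneg haar_ruelle_nonneg)
    finally show ?thesis
      using lam by (simp add: integral_haar_ruelle_clopen[OF A] emeasure_eq_measure ennreal_mult[symmetric] mult.assoc)
  qed
  have X: "seqs d \<in> clopens d" by (auto simp: clopens_def)
  have sub: "clopens d \<subseteq> Pow (seqs d)" by (auto simp: clopens_def openin_open)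
  have "A \<in> sigma_sets (seqs d) (clopens d)"
    using assms by (simp add: sets_M sets_seqs_eq_sigma_clopens)
  with Int_stable_clopens[of d] sub show ?thesis
  proof (induction rule: sigma_sets_induct_disjoint)
    case (basic A) then show ?case by (rule clopen)
  next
    case empty then show ?case by (simp add: nn_haar_ruelle_def)
  next
    case (compl A)
    then have A: "A \<in> sets M" by (simp add: sets_M sets_seqs_eq_sigma_clopens)
    have sub: "A \<subseteq> seqs d" using sets.sets_into_space[OF A] space_M by simp
    have Ac: "seqs d - A \<in> sets M" using A sets.compl_sets[of A M] by (simp add: space_M)
    \<comment> \<open>The complement case cancels the term for A from both sides, which is valid in
      \<open>ennreal\<close> only because this term is finite.\<close>
    have fin: "ennreal (d * lam) * emeasure M A < \<infinity>"
      by (simp add: ennreal_mult_less_top emeasure_eq_measure)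
    have "(\<integral>\<^sup>+x. nn_haar_ruelle d G \<beta> c (indicator (seqs d - A)) x \<partial>M) + 
          (\<integral>\<^sup>+x. nn_haar_ruelle d G \<beta> c (indicator A) x \<partial>M) =
       (\<integral>\<^sup>+x. nn_haar_ruelle d G \<beta> c (indicator (seqs d - A)) x + nn_haar_ruelle d G \<beta> c (indicator A) x \<partial>M)"
      using A Ac by (subst nn_integral_add) auto
    also have "\<dots> = (\<integral>\<^sup>+x. nn_haar_ruelle d G \<beta> c (indicator (seqs d)) x \<partial>M)"
      unfolding nn_haar_ruelle_def using sub
      by (subst nn_integral_add[symmetric])
        (auto intro!: nn_integral_cong simp: distrib_right[symmetric] split: split_indicator)
    also have "\<dots> = ennreal (d * lam) * emeasure M (seqs d)" by (rule clopen[OF X])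
    also have "emeasure M (seqs d) = emeasure M (seqs d - A) + emeasure M A"
      using A Ac sub by (subst plus_emeasure) (auto simp: Un_absorb2)
    finally show ?case
      using fin unfolding compl.IH distrib_left by (metis ennreal_add_left_cancel add.commute less_irrefl infinity_ennreal_def)
  next
    case (union A)
    have A: "A i \<in> sets M" for i
      unfolding sets_M sets_seqs_eq_sigma_clopens using union.hyps(2) by (rule range_subsetD)
    \<comment> \<open>By disjointness the indicator of the union is the series of the indicators.
      The series is exchanged first with the counting integral inside the operator, then with the
      integral against M.\<close>
    have "(\<integral>\<^sup>+x. nn_haar_ruelle d G \<beta> c (indicator (\<Union>i. A i)) x \<partial>M) =
       (\<integral>\<^sup>+x. (\<Sum>i. nn_haar_ruelle d G \<beta> c (indicator (A i)) x) \<partial>M)"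
      unfolding nn_haar_ruelle_def
      by (subst nn_integral_suminf[symmetric]) (auto simp: suminf_indicator[OF union.hyps(1), symmetric])
    also have "\<dots> = (\<Sum>i. ennreal (d * lam) * emeasure M (A i))"
      using A union.IH by (subst nn_integral_suminf) auto
    also have "\<dots> = ennreal (d * lam) * emeasure M (\<Union>i. A i)"
      using A union.hyps(1) by (simp add: suminf_emeasure[symmetric] image_subset_iff)
    finally show ?case .
  qed
qed

text \<open>Both sides are additive, homogeneous and continuous along increasing sequences in
  \<open>f\<close>, so induction over nonnegative Borel functions starts from indicators.\<close>

lemma nn_integral_haar_ruelle:
  assumes "f \<in> borel_measurable M"
  shows "(\<integral>\<^sup>+x. nn_haar_ruelle d G \<beta> c f x \<partial>M) = ennreal (d * lam) * (\<integral>\<^sup>+x. f x \<partial>M)"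
  using assms
proof (induction rule: borel_measurable_induct)
  case (cong f g)
  \<comment> \<open>Here \<open>f\<close> and \<open>g\<close> agree only on the sequence space. For
    \<open>x\<close> in that space the operator evaluates them only at points of it, since G relates
    only such points.\<close>
  have "nn_haar_ruelle d G \<beta> c f x = nn_haar_ruelle d G \<beta> c g x" if "x \<in> space M" for x
    unfolding nn_haar_ruelle_def using cong(3) G(1) that cons_seq_in_seqs
    by (intro nn_integral_cong) (auto simp: space_M equiv_def refl_on_def)
  with cong show ?case by (simp cong: nn_integral_cong)
next
  case (set A)
  then show ?case by (simp add: nn_integral_haar_ruelle_indicator)
next
  case (mult u a)
  have "nn_haar_ruelle d G \<beta> c (\<lambda>x. a * u x) = (\<lambda>x. a * nn_haar_ruelle d G \<beta> c u x)"
    by (auto simp: nn_haar_ruelle_def mult.assoc nn_integral_cmult)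
  with mult show ?case by (simp add: nn_integral_cmult mult_ac)
next
  case (add u v)
  have "nn_haar_ruelle d G \<beta> c (\<lambda>x. v x + u x) = (\<lambda>x. nn_haar_ruelle d G \<beta> c v x + nn_haar_ruelle d G \<beta> c u x)"
    by (auto simp: nn_haar_ruelle_def distrib_right nn_integral_add)
  with add show ?case by (simp add: nn_integral_add distrib_left)
next
  case (seq U)
  have U_mono: "U m y \<le> U n y" if "m \<le> n" for m n y
    using incseqD[OF \<open>incseq U\<close> that] by (simp add: le_fun_def)
  have inc: "incseq (\<lambda>i. nn_haar_ruelle d G \<beta> c (U i))"
    using U_mono by (auto simp: incseq_def le_fun_def nn_haar_ruelle_def intro!: nn_integral_mono mult_right_mono)
  \<comment> \<open>Monotone convergence for the counting measure inside the operator; the same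
    theorem for M is applied afterwards.\<close>
  have "nn_haar_ruelle d G \<beta> c (Sup (range U)) x = (SUP i. nn_haar_ruelle d G \<beta> c (U i) x)" for x
    unfolding nn_haar_ruelle_def using U_mono
    by (subst nn_integral_monotone_convergence_SUP[symmetric])
      (auto simp: SUP_mult_right_ennreal image_comp incseq_def le_fun_def intro!: mult_right_mono nn_integral_cong)
  then have "(\<integral>\<^sup>+x. nn_haar_ruelle d G \<beta> c (Sup (range U)) x \<partial>M) = (SUP i. ennreal (d * lam) * (\<integral>\<^sup>+x. U i x \<partial>M))"
    using inc seq by (simp add: nn_integral_monotone_convergence_SUP)
  also have "\<dots> = ennreal (d * lam) * (\<integral>\<^sup>+x. (Sup (range U)) x \<partial>M)"
    using seq by (simp add: SUP_mult_left_ennreal[symmetric] nn_integral_monotone_convergence_SUP image_comp)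
  finally show ?case .
qed

section \<open>From the eigenvalue equation to quasi-invariance\<close>

text \<open>\<open>measurable_class_sum\<close> sums over the second argument. For the first sum, F
  is composed with the swap of coordinates, which is continuous and maps G into itself by
  symmetry.\<close>

lemma measurable_class_sum_M:
  fixes F :: "point \<times> point \<Rightarrow> real"
  assumes F: "F \<in> borel_measurable (restrict_space borel G)"
  shows "(\<lambda>x. \<Sum>s\<in>G `` {x}. F (s, x)) \<in> borel_measurable M"
    and "(\<lambda>x. \<Sum>s\<in>G `` {x}. F (x, s) * exp (- \<beta> * c (x, s))) \<in> borel_measurable M"
proof -
  have "(\<lambda>p. (snd p, fst p)) \<in> restrict_space borel G \<rightarrow>\<^sub>M restrict_space borel G"
  proof (rule measurable_restrict_space2)
    show "(\<lambda>p. (snd p, fst p)) \<in> borel_measurable (restrict_space borel G)"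
      by (intro borel_measurable_continuous_on_restrict continuous_intros)
    show "(\<lambda>p. (snd p, fst p)) \<in> space (restrict_space borel G) \<rightarrow> G"
      using G(1) by (auto simp: equiv_def sym_def space_restrict_space)
  qed
  from measurable_class_sum[OF G(2,1,3) measurable_compose[OF this F]]
  show "(\<lambda>x. \<Sum>s\<in>G `` {x}. F (s, x)) \<in> borel_measurable M"
    by (simp add: measurable_cong_sets[OF sets_M refl])
  have "(\<lambda>p. F p * exp (- \<beta> * c p)) \<in> borel_measurable (restrict_space borel G)"
    using F measurable_exp_cocycle by measurable
  from measurable_class_sum[OF G(2,1,3) this]
  show "(\<lambda>x. \<Sum>s\<in>G `` {x}. F (x, s) * exp (- \<beta> * c (x, s))) \<in> borel_measurable M"
    by (simp add: measurable_cong_sets[OF sets_M refl])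
qed

text \<open>Both integrands have the same image under the operator: inside one class the two double sums
  differ by renaming, because \<open>c (y, s) + c (s, t) = c (y, t)\<close>.\<close>

lemma nn_integral_quasi_invariant:
  assumes h: "h \<in> borel_measurable (restrict_space borel G)" and nonneg: "\<And>p. 0 \<le> h p"
  shows "(\<integral>\<^sup>+x. ennreal (\<Sum>s\<in>G `` {x}. h (s, x)) \<partial>M) =
    (\<integral>\<^sup>+x. ennreal (\<Sum>s\<in>G `` {x}. h (x, s) * exp (- \<beta> * c (x, s))) \<partial>M)"
proof -
  define u where "u x = (\<Sum>s\<in>G `` {x}. h (s, x))" for x
  define v where "v x = (\<Sum>s\<in>G `` {x}. h (x, s) * exp (- \<beta> * c (x, s)))" for x
  have meas: "u \<in> borel_measurable M" "v \<in> borel_measurable M"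
    unfolding u_def v_def by (rule measurable_class_sum_M[OF h])+
  have pos: "0 \<le> u x" "0 \<le> v x" for x
    using nonneg by (auto simp: u_def v_def intro!: sum_nonneg mult_nonneg_nonneg)
  have class_eq: "(\<Sum>s\<in>G `` {y}. u s * exp (- \<beta> * c (y, s))) = (\<Sum>s\<in>G `` {y}. v s * exp (- \<beta> * c (y, s)))" for y
  proof -
    have cl: "G `` {s} = G `` {y}" if "s \<in> G `` {y}" for s
      using equiv_class_eq[OF G(1), of y s] that by auto
    have "(\<Sum>s\<in>G `` {y}. v s * exp (- \<beta> * c (y, s))) =
        (\<Sum>s\<in>G `` {y}. \<Sum>t\<in>G `` {y}. h (s, t) * exp (- \<beta> * c (y, t)))"
    proof (rule sum.cong[OF refl])
      fix s assume s: "s \<in> G `` {y}"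
      have "h (s, t) * exp (- \<beta> * c (s, t)) * exp (- \<beta> * c (y, s)) = h (s, t) * exp (- \<beta> * c (y, t))"
        if "t \<in> G `` {y}" for t
      proof -
        have "c (y, t) = c (y, s) + c (s, t)"
          using c(2) s that cl[OF s] unfolding cocycle_def by (metis Image_singleton_iff)
        then have "- \<beta> * c (y, t) = - \<beta> * c (s, t) + - \<beta> * c (y, s)"
          by (simp add: distrib_left)
        then show ?thesis by (simp only: exp_add mult.assoc)
      qed
      then show "v s * exp (- \<beta> * c (y, s)) = (\<Sum>t\<in>G `` {y}. h (s, t) * exp (- \<beta> * c (y, t)))"
        unfolding v_def cl[OF s] sum_distrib_right by (intro sum.cong refl)
    qed
    also have "\<dots> = (\<Sum>t\<in>G `` {y}. \<Sum>s\<in>G `` {y}. h (s, t) * exp (- \<beta> * c (y, t)))"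
      by (rule sum.swap)
    also have "\<dots> = (\<Sum>s\<in>G `` {y}. u s * exp (- \<beta> * c (y, s)))"
      unfolding u_def by (intro sum.cong refl) (simp add: cl sum_distrib_right)
    finally show ?thesis ..
  qed
  have "haar_ruelle d G \<beta> c u = haar_ruelle d G \<beta> c v"
    unfolding haar_ruelle_def class_eq ..
  then have "(\<integral>\<^sup>+x. nn_haar_ruelle d G \<beta> c (\<lambda>x. ennreal (u x)) x \<partial>M) =
      (\<integral>\<^sup>+x. nn_haar_ruelle d G \<beta> c (\<lambda>x. ennreal (v x)) x \<partial>M)"
    using pos by (intro nn_integral_cong) (simp add: nn_haar_ruelle_ennreal[OF d] space_M)
  then have "ennreal (d * lam) * (\<integral>\<^sup>+x. ennreal (u x) \<partial>M) = ennreal (d * lam) * (\<integral>\<^sup>+x. ennreal (v x) \<partial>M)"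
    using meas by (simp add: nn_integral_haar_ruelle)
  \<comment> \<open>The constant \<open>d * lam\<close> is neither 0 nor infinite, so it cancels
    even if the two integrals are infinite.\<close>
  then have "(\<integral>\<^sup>+x. ennreal (u x) \<partial>M) = (\<integral>\<^sup>+x. ennreal (v x) \<partial>M)"
    using d lam by (simp add: ennreal_mult_cancel_left)
  then show ?thesis unfolding u_def v_def .
qed

text \<open>The nonnegative case is applied to the positive and negative parts of \<open>h\<close>;
  integrability lets the two identities be subtracted.\<close>

lemma quasi_invariant_of_eigenmeasure: "quasi_invariant G c \<beta> M"
  unfolding quasi_invariant_def
proof (intro allI impI)
  fix h :: "point \<times> point \<Rightarrow> real"
  assume h: "h \<in> borel_measurable (restrict_space borel G)"
    and int1: "integrable M (\<lambda>x. \<Sum>s\<in>G `` {x}. \<bar>h (s, x)\<bar>)"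
    and int2: "integrable M (\<lambda>x. \<Sum>s\<in>G `` {x}. \<bar>h (x, s)\<bar> * exp (- \<beta> * c (x, s)))"
  \<comment> \<open>Any nonnegative Borel \<open>g\<close> below the absolute value of
    \<open>h\<close> inherits integrability of both class sums by domination, so the identity of
    nonnegative integrals becomes one of real integrals.\<close>
  have part: "integrable M (\<lambda>x. \<Sum>s\<in>G `` {x}. g (s, x)) \<and>
      integrable M (\<lambda>x. \<Sum>s\<in>G `` {x}. g (x, s) * exp (- \<beta> * c (x, s))) \<and>
      (\<integral>x. (\<Sum>s\<in>G `` {x}. g (s, x)) \<partial>M) = (\<integral>x. (\<Sum>s\<in>G `` {x}. g (x, s) * exp (- \<beta> * c (x, s))) \<partial>M)"
    if g: "g \<in> borel_measurable (restrict_space borel G)" "\<And>p. 0 \<le> g p" "\<And>p. g p \<le> \<bar>h p\<bar>"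
    for g :: "point \<times> point \<Rightarrow> real"
  proof (intro conjI)
    have bound: "norm (sum f S) \<le> norm (sum f' S)"
      if "\<And>s. 0 \<le> f s" "\<And>s. f s \<le> f' s" for f f' :: "point \<Rightarrow> real" and S
    proof -
      have "0 \<le> sum f S" "sum f S \<le> sum f' S" using that by (auto intro: sum_nonneg sum_mono)
      then show ?thesis by simp
    qed
    show "integrable M (\<lambda>x. \<Sum>s\<in>G `` {x}. g (s, x))"
      by (rule Bochner_Integration.integrable_bound[OF int1 measurable_class_sum_M(1)[OF g(1)]])
        (intro AE_I2 bound g)
    show "integrable M (\<lambda>x. \<Sum>s\<in>G `` {x}. g (x, s) * exp (- \<beta> * c (x, s)))"
      by (rule Bochner_Integration.integrable_bound[OF int2 measurable_class_sum_M(2)[OF g(1)]])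
        (intro AE_I2 bound mult_nonneg_nonneg mult_right_mono g exp_ge_zero)
    show "(\<integral>x. (\<Sum>s\<in>G `` {x}. g (s, x)) \<partial>M) = (\<integral>x. (\<Sum>s\<in>G `` {x}. g (x, s) * exp (- \<beta> * c (x, s))) \<partial>M)"
      using measurable_class_sum_M[OF g(1)] nn_integral_quasi_invariant[OF g(1,2)] g(2)
      by (simp add: integral_eq_nn_integral sum_nonneg)
  qed
  define p where "p z = max 0 (h z)" for z
  define n where "n z = max 0 (- h z)" for z
  have hpn: "h z = p z - n z" for z by (auto simp: p_def n_def)
  have P: "p \<in> borel_measurable (restrict_space borel G)" "n \<in> borel_measurable (restrict_space borel G)"
    unfolding p_def n_def using h by measurable
  note pp = part[of p, OF P(1)] and nn = part[of n, OF P(2)]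
  have "\<And>z. 0 \<le> p z" "\<And>z. p z \<le> \<bar>h z\<bar>" "\<And>z. 0 \<le> n z" "\<And>z. n z \<le> \<bar>h z\<bar>"
    by (auto simp: p_def n_def)
  with pp nn show "(\<integral>x. (\<Sum>s\<in>G `` {x}. h (s, x)) \<partial>M) =
      (\<integral>x. (\<Sum>s\<in>G `` {x}. h (x, s) * exp (- \<beta> * c (x, s))) \<partial>M)"
    unfolding hpn by (simp add: sum_subtractf left_diff_distrib)
qed

end

end

theorem theorem2p3:
  fixes d :: nat
    and G :: "(point \<times> point) set"
    and c :: "point \<times> point \<Rightarrow> real"
    and \<beta> lam :: real
    and M :: "point measure"
  assumes "d \<ge> 1"
    and "equiv (seqs d) G"
    and "\<And>x. x \<in> seqs d \<Longrightarrow> finite (G `` {x})"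
    and "hemicontinuous_classes d G"
    and "continuous_groupoid d G"
    and "\<beta> > 0"
    and "cocycle G c"
    and "continuous_on G c"
    and "finite_borel_measure d M"
    and "lam > 0"
    and "is_dual_image d (haar_ruelle d G \<beta> c) M (scale_measure (ennreal lam) M)"
  shows "quasi_invariant G c \<beta> M"
  by (rule quasi_invariant_of_eigenmeasure) (use assms in auto)

end
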